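(* Let $q$ and $k$ be fixed positive integers. Let $\mathcal{A}$ be the set of all (isomorphism classes of) $k$-vertex graphs $H$ with $\omega(H) < q$ and $\chi(H) \geq 5$. For each $H \in \mathcal{A}$ let $\mathcal{M}(H)$ be the family of all subsets $M \subseteq V(H)$ such that (a) the induced subgraph $H[M]$ contains no $K_{q-1}$; (b) $M \not\subseteq N_H(v)$ for every $v \in V(H)$; (c) $M$ is a marked vertex set in $H$. For each $H \in \mathcal{A}$ and each nonempty minimal complete subfamily $\{M_{i_1}, \dots, M_{i_s}\}$ of $\mathcal{M}(H)$, form the graph $G(M_{i_1},\dots,M_{i_s})$ by adding to $H$ new pairwise non-adjacent vertices $v_1,\dots,v_s$ with the neighborhood of $v_j$ equal to $M_{i_j}$, $j = 1,\dots,s$. Let $\mathcal{B}$ be the set of all graphs so formed, after keeping one graph from each isomorphism class and then removing all graphs which are not minimal $(3,3)$-Ramsey graphs. Then, up to isomorphism, $\mathcal{B}$ coincides with the set of all minimal $(3,3)$-Ramsey graphs $G$ for which $\omega(G) < q$ and $\alpha(G) \geq |V(G)| - k \geq 1$.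
   Context: All graphs are finite, undirected, without loops or multiple edges. $\omega,\alpha,\chi$ denote clique, independence and chromatic number; $N_H(v)$ is the set of vertices of $H$ adjacent to $v$. A graph $G$ is a $(3,3)$-Ramsey graph, written $G \rightarrow (3,3)$, if every 2-coloring of its edges contains a monochromatic triangle. $G$ is a minimal $(3,3)$-Ramsey graph if $G \rightarrow (3,3)$ and no proper subgraph $H$ of $G$ satisfies $H \rightarrow (3,3)$. A 2-coloring of the edges of a graph is $(3,3)$-free if it has no monochromatic triangle. For $M \subseteq V(H)$ let $H_M$ be the graph obtained from $H$ by adding a new vertex whose set of neighbors is $M$. $M$ is a marked vertex set in $H$ if there is a $(3,3)$-free 2-coloring of the edges of $H$ which cannot be extended to a $(3,3)$-free 2-coloring of the edges of $H_M$. A family $\{M_1,\dots,M_s\}$ of marked vertex sets in $H$ is complete if for each $(3,3)$-free 2-coloring of the edges of $H$ there is $i \in \{1,\dots,s\}$ such that this coloring cannot be extended to a $(3,3)$-free 2-coloring of the edges of $H_{M_i}$. A complete family is minimal if it contains no proper complete subfamily. *)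

theory Defs
  imports Main "HOL-Library.Ramsey" "HOL-Library.Infinite_Typeclass"
begin

datatype 'a graph = Graph (verts: "'a set") (edges: "'a set set")

definition simple_graph :: "'a graph \<Rightarrow> bool" where
  "simple_graph G \<longleftrightarrow> finite (verts G) \<and> edges G \<subseteq> [verts G]\<^bsup>2\<^esup>"

definition subgraph :: "'a graph \<Rightarrow> 'a graph \<Rightarrow> bool" where
  "subgraph H G \<longleftrightarrow> simple_graph H \<and> verts H \<subseteq> verts G \<and> edges H \<subseteq> edges G"

definition induced :: "'a graph \<Rightarrow> 'a set \<Rightarrow> 'a graph" where
  "induced G M = Graph M {e \<in> edges G. e \<subseteq> M}"

definition neighborhood :: "'a graph \<Rightarrow> 'a \<Rightarrow> 'a set" where
  "neighborhood G v = {u \<in> verts G. {u, v} \<in> edges G}"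

definition graph_iso :: "'a graph \<Rightarrow> 'b graph \<Rightarrow> bool" where
  "graph_iso G G' \<longleftrightarrow> (\<exists>f. bij_betw f (verts G) (verts G') \<and>
     (\<forall>x \<in> verts G. \<forall>y \<in> verts G. {x, y} \<in> edges G \<longleftrightarrow> {f x, f y} \<in> edges G'))"

text \<open>\<open>R\<close> consists of exactly one graph from each isomorphism class occurring in \<open>S\<close>.\<close>

definition iso_representatives :: "'a graph set \<Rightarrow> 'a graph set \<Rightarrow> bool" where
  "iso_representatives R S \<longleftrightarrow> R \<subseteq> S \<and> (\<forall>G \<in> S. \<exists>!G'. G' \<in> R \<and> graph_iso G G')"

definition is_clique :: "'a graph \<Rightarrow> 'a set \<Rightarrow> bool" where
  "is_clique G K \<longleftrightarrow> K \<subseteq> verts G \<and> [K]\<^bsup>2\<^esup> \<subseteq> edges G"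

definition is_independent :: "'a graph \<Rightarrow> 'a set \<Rightarrow> bool" where
  "is_independent G I \<longleftrightarrow> I \<subseteq> verts G \<and> [I]\<^bsup>2\<^esup> \<inter> edges G = {}"

definition contains_complete :: "'a graph \<Rightarrow> nat \<Rightarrow> bool" where
  "contains_complete G n \<longleftrightarrow> (\<exists>K. is_clique G K \<and> finite K \<and> card K = n)"

definition clique_number :: "'a graph \<Rightarrow> nat" where
  "clique_number G = Max (card ` {K. is_clique G K})"

definition independence_number :: "'a graph \<Rightarrow> nat" where
  "independence_number G = Max (card ` {I. is_independent G I})"

definition proper_vertex_coloring :: "'a graph \<Rightarrow> nat \<Rightarrow> ('a \<Rightarrow> nat) \<Rightarrow> bool" where
  "proper_vertex_coloring G n f \<longleftrightarrow> f ` verts G \<subseteq> {..<n} \<and>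
     (\<forall>x \<in> verts G. \<forall>y \<in> verts G. {x, y} \<in> edges G \<longrightarrow> f x \<noteq> f y)"

definition chromatic_number :: "'a graph \<Rightarrow> nat" where
  "chromatic_number G = (LEAST n. \<exists>f. proper_vertex_coloring G n f)"

text \<open>
  A 2-coloring of the edges of \<open>G\<close> is given by a total function into \<^typ>\<open>bool\<close>, of which
  only the values on \<open>edges G\<close> matter.
\<close>

definition mono_triangle :: "'a graph \<Rightarrow> ('a set \<Rightarrow> bool) \<Rightarrow> 'a set \<Rightarrow> bool" where
  "mono_triangle G c T \<longleftrightarrow> T \<in> [verts G]\<^bsup>3\<^esup> \<and> is_clique G T \<and> (\<exists>b. \<forall>e \<in> [T]\<^bsup>2\<^esup>. c e = b)"

definition free33 :: "'a graph \<Rightarrow> ('a set \<Rightarrow> bool) \<Rightarrow> bool" where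
  "free33 G c \<longleftrightarrow> (\<nexists>T. mono_triangle G c T)"

definition ramsey33 :: "'a graph \<Rightarrow> bool" where
  "ramsey33 G \<longleftrightarrow> (\<forall>c. \<exists>T. mono_triangle G c T)"

definition minimal_ramsey33 :: "'a graph \<Rightarrow> bool" where
  "minimal_ramsey33 G \<longleftrightarrow> simple_graph G \<and> ramsey33 G \<and>
     (\<forall>H. subgraph H G \<and> H \<noteq> G \<longrightarrow> \<not> ramsey33 H)"

text \<open>
  Adding to \<open>H\<close>, for every \<open>M \<in> S\<close>, a new vertex \<open>v M\<close> with set of neighbors \<open>M\<close>.  This is
  the intended graph only if \<open>v\<close> is injective on \<open>S\<close> and its values avoid \<open>verts H\<close>.
\<close>

definition add_vertices :: "'a graph \<Rightarrow> 'a set set \<Rightarrow> ('a set \<Rightarrow> 'a) \<Rightarrow> 'a graph" where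
  "add_vertices H S v = Graph (verts H \<union> v ` S) (edges H \<union> {{v M, u} |M u. M \<in> S \<and> u \<in> M})"

text \<open>
  The graph \<open>H\<^sub>M\<close>.  The chosen vertex is indeed new, since \<open>verts H\<close> is finite and vertices
  are drawn from an infinite type.
\<close>

definition add_vertex :: "'a::infinite graph \<Rightarrow> 'a set \<Rightarrow> 'a graph" where
  "add_vertex H M = add_vertices H {M} (\<lambda>_. SOME x. x \<notin> verts H)"

definition extendable :: "'a::infinite graph \<Rightarrow> 'a set \<Rightarrow> ('a set \<Rightarrow> bool) \<Rightarrow> bool" where
  "extendable H M c \<longleftrightarrow> (\<exists>c'. (\<forall>e \<in> edges H. c' e = c e) \<and> free33 (add_vertex H M) c')"

definition marked :: "'a::infinite graph \<Rightarrow> 'a set \<Rightarrow> bool" where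
  "marked H M \<longleftrightarrow> M \<subseteq> verts H \<and> (\<exists>c. free33 H c \<and> \<not> extendable H M c)"

definition complete_family :: "'a::infinite graph \<Rightarrow> 'a set set \<Rightarrow> bool" where
  "complete_family H S \<longleftrightarrow> (\<forall>M \<in> S. marked H M) \<and>
     (\<forall>c. free33 H c \<longrightarrow> (\<exists>M \<in> S. \<not> extendable H M c))"

definition minimal_complete_family :: "'a::infinite graph \<Rightarrow> 'a set set \<Rightarrow> bool" where
  "minimal_complete_family H S \<longleftrightarrow> complete_family H S \<and> (\<forall>S'. S' \<subset> S \<longrightarrow> \<not> complete_family H S')"

definition base_graphs :: "nat \<Rightarrow> nat \<Rightarrow> 'a graph set" where
  "base_graphs q k = {H. simple_graph H \<and> card (verts H) = k \<and>
     clique_number H < q \<and> chromatic_number H \<ge> 5}"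

definition marked_candidates :: "nat \<Rightarrow> 'a::infinite graph \<Rightarrow> 'a set set" where
  "marked_candidates q H = {M. M \<subseteq> verts H \<and>
     \<not> contains_complete (induced H M) (q - 1) \<and>
     (\<forall>v \<in> verts H. \<not> M \<subseteq> neighborhood H v) \<and>
     marked H M}"

text \<open>
  All copies of the graphs \<open>G(M\<^sub>1, \<dots>, M\<^sub>s)\<close> formed from graphs \<open>H\<close> in \<open>A\<close>, for every choice
  \<open>v\<close> of the new vertices; different choices give isomorphic graphs.
\<close>

definition formed_graphs :: "nat \<Rightarrow> 'a::infinite graph set \<Rightarrow> 'a graph set" where
  "formed_graphs q A = {add_vertices H S v |H S v.
     H \<in> A \<and> S \<subseteq> marked_candidates q H \<and> S \<noteq> {} \<and> minimal_complete_family H S \<and>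
     inj_on v S \<and> v ` S \<inter> verts H = {}}"

end

theory Submission
  imports Defs
begin

text \<open>
  If \<open>I\<close> is independent in a Ramsey graph \<open>G\<close>, then \<open>\<chi>(G - I) \<ge> 5\<close>, since otherwise \<open>\<chi>(G) \<le> 5\<close>
  and a triangle-free coloring of \<open>K\<^sub>5\<close> pulls back to \<open>G\<close>.  A coloring of \<open>H = G - I\<close> extends to
  \<open>G\<close> iff it extends separately to each vertex of \<open>I\<close>, as no triangle meets \<open>I\<close> twice.  Hence \<open>G\<close>
  is Ramsey iff the neighborhoods of the vertices of \<open>I\<close> block every free coloring of \<open>H\<close>.  Since
  deleting \<open>u \<in> I\<close> destroys the Ramsey property of a minimal \<open>G\<close>, some free coloring of \<open>H\<close> is
  blocked by \<open>N(u)\<close> alone; so each \<open>N(u)\<close> is marked and the complete family is minimal.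
\<close>

section \<open>Simple graphs and their colorings\<close>

lemma edge_in_simple_graph:
  assumes "simple_graph G" "{x, y} \<in> edges G"
  shows "x \<noteq> y" "x \<in> verts G" "y \<in> verts G"
  using assms unfolding simple_graph_def nsets_def by (auto simp: subset_iff card_insert_if)

lemma simple_graph_edgeE:
  assumes "simple_graph G" "e \<in> edges G"
  obtains x y where "e = {x, y}" "x \<noteq> y" "x \<in> verts G" "y \<in> verts G"
  using assms unfolding simple_graph_def nsets_def by (auto simp: card_2_iff subset_iff)

lemma is_clique_iff:
  "is_clique G K \<longleftrightarrow> K \<subseteq> verts G \<and> (\<forall>x\<in>K. \<forall>y\<in>K. x \<noteq> y \<longrightarrow> {x, y} \<in> edges G)"
  unfolding is_clique_def nsets_2_eq by (auto simp: UN_subset_iff)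

lemma is_independent_iff:
  "is_independent G I \<longleftrightarrow> I \<subseteq> verts G \<and> (\<forall>x\<in>I. \<forall>y\<in>I. x \<noteq> y \<longrightarrow> {x, y} \<notin> edges G)"
proof -
  have "[I]\<^bsup>2\<^esup> \<inter> edges G = {} \<longleftrightarrow> [I]\<^bsup>2\<^esup> \<subseteq> - edges G" by blast
  then show ?thesis
    unfolding is_independent_def nsets_2_eq by (auto simp: UN_subset_iff)
qed

text \<open>Edges of a simple graph have distinct ends, so three pairwise adjacent vertices
  automatically form a 3-set. Triangles can thus be handled as ordered triples, the form in which
  all later colorings are checked.\<close>

lemma free33_iff:
  assumes "simple_graph G"
  shows "free33 G c \<longleftrightarrow> (\<forall>x y z. {x, y} \<in> edges G \<and> {y, z} \<in> edges G \<and> {x, z} \<in> edges G \<longrightarrow>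
    \<not> (c {x, y} = c {y, z} \<and> c {x, y} = c {x, z}))" (is "_ \<longleftrightarrow> ?R")
proof
  assume free: "free33 G c"
  show ?R
  proof (intro allI impI notI)
    fix x y z
    assume e: "{x, y} \<in> edges G \<and> {y, z} \<in> edges G \<and> {x, z} \<in> edges G"
      and c: "c {x, y} = c {y, z} \<and> c {x, y} = c {x, z}"
    have d: "x \<noteq> y" "y \<noteq> z" "x \<noteq> z" "x \<in> verts G" "y \<in> verts G" "z \<in> verts G"
      using e edge_in_simple_graph[OF assms] by blast+
    have "\<forall>e \<in> [{x, y, z}]\<^bsup>2\<^esup>. c e = c {x, y}"
      using c unfolding nsets_2_eq by (auto simp: insert_commute)
    moreover have "is_clique G {x, y, z}"
      using d e unfolding is_clique_iff by (auto simp: insert_commute)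
    moreover have "{x, y, z} \<in> [verts G]\<^bsup>3\<^esup>"
      using d by (simp add: nsets_def)
    ultimately have "mono_triangle G c {x, y, z}"
      unfolding mono_triangle_def by blast
    with free show False unfolding free33_def by blast
  qed
next
  assume R: ?R
  show "free33 G c"
    unfolding free33_def
  proof
    assume "\<exists>T. mono_triangle G c T"
    then obtain T b where T: "T \<in> [verts G]\<^bsup>3\<^esup>" "is_clique G T" "\<forall>e \<in> [T]\<^bsup>2\<^esup>. c e = b"
      unfolding mono_triangle_def by blast
    then obtain x y z where xyz: "T = {x, y, z}" "x \<noteq> y" "y \<noteq> z" "x \<noteq> z"
      unfolding nsets_def by (auto simp: card_3_iff)
    have "{x, y} \<in> edges G \<and> {y, z} \<in> edges G \<and> {x, z} \<in> edges G"
      using T(2) xyz unfolding is_clique_iff by auto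
    moreover have "c {x, y} = b" "c {y, z} = b" "c {x, z} = b"
      using T(3) xyz by (auto simp: nsets_def)
    ultimately show False using R by blast
  qed
qed

lemma ramsey33_iff: "ramsey33 G \<longleftrightarrow> (\<forall>c. \<not> free33 G c)"
  unfolding ramsey33_def free33_def by simp

section \<open>Clique and independence numbers\<close>

text \<open>Supplies the finiteness without which \<open>Max\<close> in the clique and independence
  numbers says nothing.\<close>

lemma finite_card_image_Collect_subset:
  assumes "finite V" "\<And>K. P K \<Longrightarrow> K \<subseteq> V"
  shows "finite (card ` {K. P K})"
proof (rule finite_imageI)
  have "{K. P K} \<subseteq> Pow V" using assms(2) by blast
  then show "finite {K. P K}" using assms(1) finite_subset finite_Pow_iff by blast
qed

lemma clique_number_less_iff:
  assumes "finite (verts G)"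
  shows "clique_number G < q \<longleftrightarrow> (\<forall>K. is_clique G K \<longrightarrow> card K < q)"
proof -
  have fin: "finite (card ` {K. is_clique G K})"
    using assms by (rule finite_card_image_Collect_subset) (simp add: is_clique_def)
  have "is_clique G {}" unfolding is_clique_iff by simp
  then have ne: "card ` {K. is_clique G K} \<noteq> {}" by blast
  show ?thesis
    unfolding clique_number_def Max_less_iff[OF fin ne] by simp
qed

lemma independence_number_ge_iff:
  assumes "finite (verts G)"
  shows "n \<le> independence_number G \<longleftrightarrow> (\<exists>I. is_independent G I \<and> n \<le> card I)"
proof -
  have fin: "finite (card ` {I. is_independent G I})"
    using assms by (rule finite_card_image_Collect_subset) (simp add: is_independent_def)
  have "is_independent G {}" unfolding is_independent_iff by simp
  then have ne: "card ` {I. is_independent G I} \<noteq> {}" by blast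
  show ?thesis
    unfolding independence_number_def Max_ge_iff[OF fin ne] by simp
qed

text \<open>Subsets of cliques are cliques, so a large clique can be cut down to the exact size that
  \<open>contains_complete\<close> asks for.\<close>

lemma contains_complete_le:
  assumes "is_clique G K" "finite K" "n \<le> card K"
  shows "contains_complete G n"
proof -
  obtain K' where K': "K' \<subseteq> K" "card K' = n"
    using assms obtain_subset_with_card_n by metis
  then have "is_clique G K'" using assms(1) unfolding is_clique_iff by blast
  moreover have "finite K'" using K' assms(2) finite_subset by blast
  ultimately show ?thesis using K' unfolding contains_complete_def by blast
qed

lemma simple_graph_induced:
  assumes "simple_graph G" "M \<subseteq> verts G"
  shows "simple_graph (induced G M)"
proof -
  have "finite M" using assms finite_subset unfolding simple_graph_def by blast
  then show ?thesis using assms(1) unfolding simple_graph_def induced_def nsets_def by auto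
qed

section \<open>Isomorphisms\<close>

text \<open>Replaces an isomorphic copy by an image under an explicit map, so that invariance of a
  property becomes a statement about one function.\<close>

definition map_graph :: "('a \<Rightarrow> 'b) \<Rightarrow> 'a graph \<Rightarrow> 'b graph" where
  "map_graph f G = Graph (f ` verts G) ((`) f ` edges G)"

lemma map_graph_sel:
  "verts (map_graph f G) = f ` verts G" "edges (map_graph f G) = (`) f ` edges G"
  by (simp_all add: map_graph_def)

lemma simple_graph_map:
  assumes "simple_graph G" "inj_on f (verts G)"
  shows "simple_graph (map_graph f G)"
  unfolding simple_graph_def
proof
  show "finite (verts (map_graph f G))"
    using assms by (simp add: map_graph_sel simple_graph_def)
  show "edges (map_graph f G) \<subseteq> [verts (map_graph f G)]\<^bsup>2\<^esup>"
  proof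
    fix e assume "e \<in> edges (map_graph f G)"
    then obtain e' where "e' \<in> edges G" "e = f ` e'" by (auto simp: map_graph_sel)
    moreover from simple_graph_edgeE[OF assms(1) this(1)]
    obtain x y where "e' = {x, y}" "x \<noteq> y" "x \<in> verts G" "y \<in> verts G" .
    ultimately show "e \<in> [verts (map_graph f G)]\<^bsup>2\<^esup>"
      using assms(2) by (auto simp: map_graph_sel nsets_def inj_on_def card_insert_if)
  qed
qed

lemma map_graph_edge_iff:
  assumes "simple_graph G" "inj_on f (verts G)" "x \<in> verts G" "y \<in> verts G"
  shows "{f x, f y} \<in> edges (map_graph f G) \<longleftrightarrow> {x, y} \<in> edges G"
proof
  assume "{x, y} \<in> edges G"
  then show "{f x, f y} \<in> edges (map_graph f G)"
    by (auto simp: map_graph_sel intro!: image_eqI[of _ _ "{x, y}"])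
next
  assume "{f x, f y} \<in> edges (map_graph f G)"
  then obtain e where e: "e \<in> edges G" "f ` {x, y} = f ` e" by (auto simp: map_graph_sel)
  then have "e \<subseteq> verts G" using simple_graph_edgeE[OF assms(1)] by blast
  then have "{x, y} = e" using e assms inj_on_image_eq_iff by (metis empty_subsetI insert_subset)
  then show "{x, y} \<in> edges G" using e by simp
qed

text \<open>Since the inverse recovers \<open>G\<close> exactly, cliques and subgraphs of the image
  can be pulled back with the same lemmas that push them forward.\<close>

lemma map_graph_inv_into:
  assumes "simple_graph G" "inj_on f (verts G)"
  shows "map_graph (inv_into (verts G) f) (map_graph f G) = G"
proof -
  have "inv_into (verts G) f ` f ` e = e" if "e \<in> edges G" for e
    using that assms simple_graph_edgeE[OF assms(1) that]
    by (metis empty_subsetI inv_into_image_cancel insert_subset)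
  then have "(\<lambda>e. inv_into (verts G) f ` f ` e) ` edges G = edges G" by simp
  then show ?thesis
    using assms by (intro graph.expand) (auto simp: map_graph_sel image_image)
qed

lemma graph_iso_map:
  assumes "simple_graph G" "inj_on f (verts G)"
  shows "graph_iso G (map_graph f G)"
  unfolding graph_iso_def
proof (intro exI conjI ballI)
  show "bij_betw f (verts G) (verts (map_graph f G))"
    using assms by (simp add: bij_betw_def map_graph_sel)
qed (simp add: map_graph_edge_iff assms)

text \<open>\<open>graph_iso\<close> only compares pairs of vertices. In simple graphs every edge is
  such a pair, so this comparison upgrades to an equality of graphs.\<close>

lemma graph_isoE:
  assumes "graph_iso G G'" "simple_graph G" "simple_graph G'"
  obtains f where "inj_on f (verts G)" "G' = map_graph f G"
proof -
  obtain f where f: "bij_betw f (verts G) (verts G')"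
    and e: "\<forall>x \<in> verts G. \<forall>y \<in> verts G. {x, y} \<in> edges G \<longleftrightarrow> {f x, f y} \<in> edges G'"
    using assms unfolding graph_iso_def by blast
  have inj: "inj_on f (verts G)" and im: "f ` verts G = verts G'"
    using f by (auto simp: bij_betw_def)
  have s: "simple_graph (map_graph f G)" using assms inj simple_graph_map by blast
  have "{u, w} \<in> edges G' \<longleftrightarrow> {u, w} \<in> edges (map_graph f G)"
    if "u \<in> verts G'" "w \<in> verts G'" for u w
    using that e map_graph_edge_iff[OF assms(2) inj] unfolding im[symmetric] by auto
  moreover have v: "verts (map_graph f G) = verts G'" using im by (simp add: map_graph_sel)
  ultimately have "edges G' = edges (map_graph f G)"
    using simple_graph_edgeE[OF assms(3)] simple_graph_edgeE[OF s] by (metis subsetI subset_antisym)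
  then show ?thesis using that inj v by (metis graph.expand)
qed

lemma graph_iso_sym:
  assumes "graph_iso G G'"
  shows "graph_iso G' G"
proof -
  obtain f where f: "bij_betw f (verts G) (verts G')"
    and e: "\<forall>x \<in> verts G. \<forall>y \<in> verts G. {x, y} \<in> edges G \<longleftrightarrow> {f x, f y} \<in> edges G'"
    using assms unfolding graph_iso_def by blast
  let ?g = "inv_into (verts G) f"
  have "?g x \<in> verts G" "f (?g x) = x" if "x \<in> verts G'" for x
    using f that by (auto simp: bij_betw_def inv_into_into f_inv_into_f)
  then show ?thesis
    using f e unfolding graph_iso_def
    by (intro exI[of _ ?g]) (auto simp: bij_betw_inv_into)
qed

lemma graph_iso_trans:
  assumes "graph_iso G G'" "graph_iso G' G''"
  shows "graph_iso G G''"
proof -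
  obtain f g where f: "bij_betw f (verts G) (verts G')" and g: "bij_betw g (verts G') (verts G'')"
    and "\<forall>x \<in> verts G. \<forall>y \<in> verts G. {x, y} \<in> edges G \<longleftrightarrow> {f x, f y} \<in> edges G'"
    and "\<forall>x \<in> verts G'. \<forall>y \<in> verts G'. {x, y} \<in> edges G' \<longleftrightarrow> {g x, g y} \<in> edges G''"
    using assms unfolding graph_iso_def by blast
  then have "\<forall>x \<in> verts G. \<forall>y \<in> verts G.
      {x, y} \<in> edges G \<longleftrightarrow> {(g \<circ> f) x, (g \<circ> f) y} \<in> edges G''"
    using bij_betwE[OF f] by auto
  then show ?thesis using bij_betw_trans[OF f g] unfolding graph_iso_def by blast
qed

lemma is_clique_map:
  assumes "is_clique G K"
  shows "is_clique (map_graph f G) (f ` K)"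
  unfolding is_clique_iff
proof (intro conjI ballI impI)
  show "f ` K \<subseteq> verts (map_graph f G)"
    using assms by (auto simp: is_clique_def map_graph_sel)
  fix x y assume "x \<in> f ` K" "y \<in> f ` K" "x \<noteq> y"
  then obtain u w where "u \<in> K" "w \<in> K" "x = f u" "y = f w" "u \<noteq> w" by blast
  with assms show "{x, y} \<in> edges (map_graph f G)"
    by (auto simp: is_clique_iff map_graph_sel intro!: image_eqI[of _ _ "{u, w}"])
qed

lemma inj_on_inv_into_map:
  "inj_on (inv_into (verts G) f) (verts (map_graph f G))"
  by (simp add: map_graph_sel inj_on_inv_into)

lemma clique_number_map_less:
  assumes "simple_graph G" "inj_on f (verts G)" "clique_number G < q"
  shows "clique_number (map_graph f G) < q"
proof -
  let ?G = "map_graph f G" and ?g = "inv_into (verts G) f"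
  have fin: "finite (verts G)" "finite (verts ?G)"
    using assms by (auto simp: simple_graph_def map_graph_sel)
  have "card K < q" if "is_clique ?G K" for K
  proof -
    have "is_clique G (?g ` K)"
      using is_clique_map[OF that, of ?g] map_graph_inv_into[OF assms(1,2)] by simp
    moreover have "card (?g ` K) = card K"
      using that inj_on_inv_into_map[of G f] inj_on_subset card_image
      unfolding is_clique_def by blast
    ultimately show ?thesis using assms(3) clique_number_less_iff[OF fin(1)] by metis
  qed
  then show ?thesis using clique_number_less_iff[OF fin(2)] by blast
qed

text \<open>A free coloring of the image, composed with \<open>f\<close> on edges, would be a free
  coloring of \<open>G\<close>.\<close>

lemma ramsey33_map:
  assumes "simple_graph G" "inj_on f (verts G)" "ramsey33 G"
  shows "ramsey33 (map_graph f G)"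
  unfolding ramsey33_iff
proof (intro allI notI)
  fix c assume c: "free33 (map_graph f G) c"
  have e: "{f x, f y} \<in> edges (map_graph f G)" if "{x, y} \<in> edges G" for x y
    using that by (auto simp: map_graph_sel intro!: image_eqI[of _ _ "{x, y}"])
  have "free33 G (\<lambda>e. c (f ` e))"
    using c e unfolding free33_iff[OF assms(1)] free33_iff[OF simple_graph_map[OF assms(1,2)]]
    by simp
  then show False using assms(3) unfolding ramsey33_iff by blast
qed

text \<open>A proper Ramsey subgraph of the image would pull back to a proper Ramsey subgraph of
  \<open>G\<close>.\<close>

lemma minimal_ramsey33_map:
  assumes "minimal_ramsey33 G" "inj_on f (verts G)"
  shows "minimal_ramsey33 (map_graph f G)"
  unfolding minimal_ramsey33_def
proof (intro conjI allI impI)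
  have s: "simple_graph G" using assms by (simp add: minimal_ramsey33_def)
  show s': "simple_graph (map_graph f G)" using simple_graph_map[OF s assms(2)] .
  show "ramsey33 (map_graph f G)"
    using ramsey33_map[OF s assms(2)] assms(1) by (simp add: minimal_ramsey33_def)
  fix H assume H: "subgraph H (map_graph f G) \<and> H \<noteq> map_graph f G"
  let ?g = "inv_into (verts G) f"
  have sH: "simple_graph H" using H by (simp add: subgraph_def)
  have vH: "verts H \<subseteq> verts (map_graph f G)" using H by (simp add: subgraph_def)
  then have injH: "inj_on ?g (verts H)" using inj_on_inv_into_map inj_on_subset by blast
  have sub: "subgraph (map_graph ?g H) (map_graph ?g (map_graph f G))"
    using H simple_graph_map[OF sH injH] unfolding subgraph_def
    by (simp add: map_graph_sel image_mono)
  \<comment> \<open>Properness survives the pullback because \<open>f\<close> undoes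
    \<open>?g\<close> on the vertices of \<open>H\<close>.\<close>
  have "map_graph ?g H \<noteq> G"
  proof
    assume "map_graph ?g H = G"
    then have "map_graph f (map_graph ?g H) = map_graph f G" by simp
    moreover have "map_graph f (map_graph ?g H) = H"
    proof -
      have "f (?g x) = x" if "x \<in> verts H" for x
        using that vH by (auto simp: map_graph_sel f_inv_into_f)
      then have "f ` ?g ` e = e" if "e \<subseteq> verts H" for e
        using that by (force simp: image_image)
      moreover have "e \<subseteq> verts H" if "e \<in> edges H" for e
        using simple_graph_edgeE[OF sH that] by blast
      ultimately show ?thesis by (intro graph.expand) (simp add: map_graph_sel image_image)
    qed
    ultimately show False using H by simp
  qed
  then have "\<not> ramsey33 (map_graph ?g H)"
    using sub assms(1) unfolding map_graph_inv_into[OF s assms(2)] minimal_ramsey33_def by blast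
  then show "\<not> ramsey33 H" using ramsey33_map[OF sH injH] by blast
qed

section \<open>Adding vertices\<close>

text \<open>The value \<open>d x\<close> is the color of the edge joining \<open>x\<close> to the new vertex of \<open>H\<^sub>M\<close>.\<close>

definition star_extendable :: "'a graph \<Rightarrow> 'a set \<Rightarrow> ('a set \<Rightarrow> bool) \<Rightarrow> bool" where
  "star_extendable H M c \<longleftrightarrow> (\<exists>d. \<forall>x\<in>M. \<forall>y\<in>M. {x, y} \<in> edges H \<longrightarrow>
     \<not> (d x = c {x, y} \<and> d y = c {x, y}))"

text \<open>These conditions make \<open>add_vertices\<close> the intended graph. Naming a new
  vertex by its neighborhood loses nothing here: in a minimal Ramsey graph distinct vertices have
  distinct neighborhoods.\<close>

locale vertex_addition =
  fixes H :: "'a graph" and S :: "'a set set" and v :: "'a set \<Rightarrow> 'a"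
  assumes simple: "simple_graph H" and subsets: "S \<subseteq> Pow (verts H)"
    and inj: "inj_on v S" and new: "v ` S \<inter> verts H = {}"
begin

abbreviation "G \<equiv> add_vertices H S v"

lemma finite_S: "finite S"
  using simple subsets finite_subset unfolding simple_graph_def by blast

lemma verts_G: "verts G = verts H \<union> v ` S"
  by (simp add: add_vertices_def)

lemma new_notin: "M \<in> S \<Longrightarrow> v M \<notin> verts H"
  using new by blast

lemma edge_old: "x \<in> verts H \<Longrightarrow> y \<in> verts H \<Longrightarrow> {x, y} \<in> edges G \<longleftrightarrow> {x, y} \<in> edges H"
  using new by (auto simp: add_vertices_def doubleton_eq_iff)

lemma edge_new: "M \<in> S \<Longrightarrow> {v M, u} \<in> edges G \<longleftrightarrow> u \<in> M"
proof
  assume M: "M \<in> S" and e: "{v M, u} \<in> edges G"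
  have "{v M, u} \<notin> edges H" using edge_in_simple_graph(2)[OF simple] M new_notin by blast
  then obtain M' u' where "M' \<in> S" "u' \<in> M'" "{v M, u} = {v M', u'}"
    using e by (auto simp: add_vertices_def)
  \<comment> \<open>This excludes the crossed way in which the two doubletons could be
    equal.\<close>
  moreover from this have "v M \<noteq> u'" using M new_notin subsets by blast
  ultimately show "u \<in> M" using M inj by (auto simp: doubleton_eq_iff inj_on_def)
qed (auto simp: add_vertices_def)

lemma simple_G: "simple_graph G"
  unfolding simple_graph_def
proof
  show "finite (verts G)" using simple finite_S by (simp add: verts_G simple_graph_def)
  show "edges G \<subseteq> [verts G]\<^bsup>2\<^esup>"
  proof
    fix e assume "e \<in> edges G"
    then consider "e \<in> edges H" | M u where "e = {v M, u}" "M \<in> S" "u \<in> M"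
      by (auto simp: add_vertices_def)
    then show "e \<in> [verts G]\<^bsup>2\<^esup>"
    proof cases
      case 1
      then show ?thesis
        by (elim simple_graph_edgeE[OF simple]) (auto simp: verts_G nsets_def)
    next
      case 2
      then have "u \<in> verts H" "v M \<noteq> u" using subsets new_notin by blast+
      with 2 show ?thesis by (auto simp: verts_G nsets_def)
    qed
  qed
qed

lemma edges_new_new: "M \<in> S \<Longrightarrow> M' \<in> S \<Longrightarrow> {v M, v M'} \<notin> edges G"
  using edge_new new_notin subsets by blast

text \<open>New vertices are pairwise non-adjacent, so a triangle contains at most one of them. The
  colors of the edges at each new vertex can therefore be chosen independently of the other new
  vertices.\<close>

lemma free33_extension_iff:
  "(\<exists>c'. (\<forall>e \<in> edges H. c' e = c e) \<and> free33 G c') \<longleftrightarrow>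
   free33 H c \<and> (\<forall>M\<in>S. star_extendable H M c)" (is "?L \<longleftrightarrow> ?R")
proof
  assume ?L
  then obtain c' where agree: "\<And>e. e \<in> edges H \<Longrightarrow> c' e = c e" and f: "free33 G c'" by blast
  have sub: "edges H \<subseteq> edges G" by (auto simp: add_vertices_def)
  note f = f[unfolded free33_iff[OF simple_G], rule_format]
  have "free33 H c"
    unfolding free33_iff[OF simple]
  proof (intro allI impI)
    fix x y z assume e: "{x, y} \<in> edges H \<and> {y, z} \<in> edges H \<and> {x, z} \<in> edges H"
    then show "\<not> (c {x, y} = c {y, z} \<and> c {x, y} = c {x, z})"
      using f[of x y z] sub agree by auto
  qed
  moreover have "star_extendable H M c" if M: "M \<in> S" for M
    unfolding star_extendable_def
  proof (intro exI[of _ "\<lambda>x. c' {v M, x}"] ballI impI notI)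
    fix x y assume xy: "x \<in> M" "y \<in> M" "{x, y} \<in> edges H"
      and c: "c' {v M, x} = c {x, y} \<and> c' {v M, y} = c {x, y}"
    show False
      using f[of "v M" x y] xy c agree[OF xy(3)] sub edge_new[OF M] by auto
  qed
  ultimately show ?R by blast
next
  assume R: ?R
  then obtain d where d: "\<And>M x y. M \<in> S \<Longrightarrow> x \<in> M \<Longrightarrow> y \<in> M \<Longrightarrow> {x, y} \<in> edges H \<Longrightarrow>
      \<not> (d M x = c {x, y} \<and> d M y = c {x, y})"
    unfolding star_extendable_def by metis
  \<comment> \<open>An edge outside \<open>H\<close> has exactly one new end \<open>v M\<close> and
    one old end; the two \<open>THE\<close> terms recover \<open>M\<close> and the old end from the
    edge.\<close>
  define c' where "c' e = (if e \<subseteq> verts H then c e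
    else let M = (THE M. M \<in> S \<and> v M \<in> e) in d M (THE x. x \<in> e \<and> x \<in> verts H))" for e
  have old: "c' {x, y} = c {x, y}" if "x \<in> verts H" "y \<in> verts H" for x y
    using that by (simp add: c'_def)
  have new': "c' {v M, x} = d M x" if "M \<in> S" "x \<in> M" for M x
  proof -
    have x: "x \<in> verts H" using that subsets by blast
    have "(THE M'. M' \<in> S \<and> v M' \<in> {v M, x}) = M"
      using that x new_notin inj by (intro the_equality) (auto dest: inj_onD)
    moreover have "(THE y. y \<in> {v M, x} \<and> y \<in> verts H) = x"
      using that x new_notin by (intro the_equality) auto
    ultimately show ?thesis using that new_notin by (simp add: c'_def)
  qed
  \<comment> \<open>The new vertex is put in first place; the other two positions reduce to this by
    symmetry.\<close>
  have key: "\<not> (c' {v M, y} = c' {y, z} \<and> c' {v M, y} = c' {v M, z})"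
    if M: "M \<in> S" and e: "{v M, y} \<in> edges G" "{y, z} \<in> edges G" "{v M, z} \<in> edges G" for M y z
  proof -
    have yz: "y \<in> M" "z \<in> M" "y \<in> verts H" "z \<in> verts H"
      using e M edge_new subsets by blast+
    then have "{y, z} \<in> edges H" using e edge_old by blast
    from d[OF M yz(1,2) this] show ?thesis using yz M new' old by auto
  qed
  have "free33 G c'"
    unfolding free33_iff[OF simple_G]
  proof (intro allI impI)
    fix x y z assume e: "{x, y} \<in> edges G \<and> {y, z} \<in> edges G \<and> {x, z} \<in> edges G"
    have "x \<in> verts G" "y \<in> verts G" "z \<in> verts G"
      using e edge_in_simple_graph[OF simple_G] by blast+
    then consider "x \<in> v ` S" | "y \<in> v ` S" | "z \<in> v ` S"
      | "x \<in> verts H" "y \<in> verts H" "z \<in> verts H" by (auto simp: verts_G)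
    then show "\<not> (c' {x, y} = c' {y, z} \<and> c' {x, y} = c' {x, z})"
    proof cases
      case 1
      then obtain M where "M \<in> S" "x = v M" by blast
      then show ?thesis using key[of M y z] e by auto
    next
      case 2
      then obtain M where "M \<in> S" "y = v M" by blast
      then show ?thesis using key[of M x z] e by (auto simp: insert_commute)
    next
      case 3
      then obtain M where "M \<in> S" "z = v M" by blast
      then show ?thesis using key[of M x y] e by (auto simp: insert_commute)
    next
      case 4
      then show ?thesis
        using R e edge_old old unfolding free33_iff[OF simple] by metis
    qed
  qed
  moreover have "c' e = c e" if "e \<in> edges H" for e
    using that old by (elim simple_graph_edgeE[OF simple]) auto
  ultimately show ?L by blast
qed

lemma ramsey33_iff_star:
  "ramsey33 G \<longleftrightarrow> (\<forall>c. free33 H c \<longrightarrow> (\<exists>M\<in>S. \<not> star_extendable H M c))"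
proof -
  \<comment> \<open>Every coloring of \<open>G\<close> extends its own restriction to
    \<open>H\<close>, so \<open>c\<close> can be taken to be \<open>c'\<close>.\<close>
  have "\<not> ramsey33 G \<longleftrightarrow> (\<exists>c c'. (\<forall>e \<in> edges H. c' e = c e) \<and> free33 G c')"
    unfolding ramsey33_iff by blast
  then show ?thesis unfolding free33_extension_iff by blast
qed

lemma is_independent_new: "is_independent G (v ` S)"
  unfolding is_independent_iff using edges_new_new by (auto simp: verts_G)

lemma card_verts: "card (verts G) = card (verts H) + card S"
  using simple finite_S new inj unfolding verts_G simple_graph_def
  by (subst card_Un_disjoint) (auto simp: card_image)

text \<open>A clique with a new vertex \<open>v M\<close> has no other new vertex, and its remaining
  vertices form a clique inside \<open>M\<close>, hence number fewer than
  \<open>q - 1\<close>.\<close>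

lemma clique_number_less:
  assumes "clique_number H < q" "\<And>M. M \<in> S \<Longrightarrow> \<not> contains_complete (induced H M) (q - 1)"
  shows "clique_number G < q"
proof -
  have fin: "finite (verts G)" "finite (verts H)"
    using simple simple_G by (auto simp: simple_graph_def)
  have "card K < q" if K: "is_clique G K" for K
  proof (cases "K \<inter> v ` S = {}")
    case True
    then have "K \<subseteq> verts H" using K by (auto simp: is_clique_def verts_G)
    then have "is_clique H K" using K edge_old unfolding is_clique_iff by blast
    then show ?thesis using assms(1) clique_number_less_iff[OF fin(2)] by blast
  next
    case False
    then obtain M where M: "M \<in> S" "v M \<in> K" by blast
    have sub: "K - {v M} \<subseteq> M"
    proof
      fix u assume "u \<in> K - {v M}"
      then have "{v M, u} \<in> edges G" using K M(2) by (auto simp: is_clique_iff)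
      then show "u \<in> M" using edge_new[OF M(1)] by simp
    qed
    have finK: "finite K" using K fin finite_subset unfolding is_clique_def by blast
    have "is_clique (induced H M) (K - {v M})"
      unfolding is_clique_iff
    proof (intro conjI ballI impI)
      show "K - {v M} \<subseteq> verts (induced H M)" using sub by (simp add: induced_def)
      fix x y assume xy: "x \<in> K - {v M}" "y \<in> K - {v M}" "x \<noteq> y"
      then have "{x, y} \<in> edges G" using K unfolding is_clique_iff by blast
      moreover have "x \<in> M" "y \<in> M" using xy sub by blast+
      moreover from this have "x \<in> verts H" "y \<in> verts H" using M subsets by blast+
      ultimately show "{x, y} \<in> edges (induced H M)"
        using edge_old by (simp add: induced_def)
    qed
    then have "\<not> q - 1 \<le> card (K - {v M})"
      using assms(2)[OF M(1)] contains_complete_le finK by blast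
    then show ?thesis using finK M by simp
  qed
  then show ?thesis using clique_number_less_iff[OF fin(1)] by blast
qed

end

section \<open>Complete families from minimal Ramsey graphs\<close>

text \<open>The one-vertex case of \<open>free33_extension_iff\<close>. It removes the arbitrary
  choice of the new vertex in \<open>add_vertex\<close>, so extensions to the separate graphs
  \<open>H_M\<close> can be compared with extensions to \<open>G\<close>.\<close>

lemma extendable_iff:
  fixes H :: "'a::infinite graph"
  assumes "simple_graph H" "M \<subseteq> verts H"
  shows "extendable H M c \<longleftrightarrow> free33 H c \<and> star_extendable H M c"
proof -
  define x where "x = (SOME x. x \<notin> verts H)"
  have "\<exists>x. x \<notin> verts H"
    using assms infinite_UNIV ex_new_if_finite unfolding simple_graph_def by blast
  then have "x \<notin> verts H" unfolding x_def by (rule someI_ex)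
  then interpret vertex_addition H "{M}" "\<lambda>_. x"
    using assms by unfold_locales auto
  show ?thesis
    using free33_extension_iff[of c]
    unfolding extendable_def add_vertex_def x_def[symmetric] by simp
qed

lemma (in vertex_addition) vertex_addition_subset:
  "S' \<subseteq> S \<Longrightarrow> vertex_addition H S' v"
  using simple subsets inj new inj_on_subset by unfold_locales blast+

text \<open>Every \<open>M\<close> in \<open>S\<close> has a free coloring of \<open>H\<close>
  blocked by \<open>M\<close> and by no other member; markedness and minimality are both read off
  from these colorings.\<close>

lemma minimal_complete_family_if_minimal_ramsey33:
  fixes H :: "'a::infinite graph"
  assumes "vertex_addition H S v" "minimal_ramsey33 (add_vertices H S v)"
  shows "minimal_complete_family H S"
proof -
  interpret vertex_addition H S v by fact
  have ext: "extendable H M c \<longleftrightarrow> star_extendable H M c" if "M \<in> S" "free33 H c" for M c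
    using extendable_iff[OF simple] that subsets by blast
  have critical: "\<exists>c. free33 H c \<and> (\<forall>M'\<in>S - {M}. extendable H M' c)" if M: "M \<in> S" for M
  proof -
    \<comment> \<open>Dropping \<open>M\<close> from the family amounts to deleting the vertex
      \<open>v M\<close>, which yields a proper subgraph of \<open>G\<close>.\<close>
    interpret S': vertex_addition H "S - {M}" v by (rule vertex_addition_subset) blast
    have "subgraph S'.G G"
      using S'.simple_G unfolding subgraph_def by (auto simp: add_vertices_def)
    moreover have "v M \<notin> verts S'.G"
      using M new_notin inj by (auto simp: S'.verts_G dest: inj_onD)
    then have "S'.G \<noteq> G" using M verts_G by auto
    ultimately have "\<not> ramsey33 S'.G" using assms(2) by (simp add: minimal_ramsey33_def)
    then obtain c where "free33 H c" "\<forall>M'\<in>S - {M}. star_extendable H M' c"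
      unfolding S'.ramsey33_iff_star by blast
    then show ?thesis using ext by auto
  qed
  have "ramsey33 G" using assms(2) by (simp add: minimal_ramsey33_def)
  then have covers: "\<exists>M\<in>S. \<not> extendable H M c" if "free33 H c" for c
    using that ext[OF _ that] unfolding ramsey33_iff_star by auto
  have "marked H M" if M: "M \<in> S" for M
  proof -
    obtain c where c: "free33 H c" "\<forall>M'\<in>S - {M}. extendable H M' c"
      using critical[OF M] by blast
    \<comment> \<open>Some member of \<open>S\<close> blocks \<open>c\<close>, and all others have
      been ruled out.\<close>
    then have "\<not> extendable H M c" using covers[OF c(1)] by blast
    moreover have "M \<subseteq> verts H" using M subsets by blast
    ultimately show ?thesis using c(1) unfolding marked_def by blast
  qed
  then have "complete_family H S" using covers unfolding complete_family_def by blast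
  moreover have "\<not> complete_family H S'" if "S' \<subset> S" for S'
  proof -
    \<comment> \<open>A proper subfamily misses some \<open>M\<close>, and the coloring blocked only
      by \<open>M\<close> escapes it.\<close>
    obtain M where M: "M \<in> S" "S' \<subseteq> S - {M}" using \<open>S' \<subset> S\<close> by blast
    obtain c where "free33 H c" "\<forall>M'\<in>S - {M}. extendable H M' c"
      using critical[OF M(1)] by blast
    with M(2) have "free33 H c \<and> \<not> (\<exists>M\<in>S'. \<not> extendable H M c)" by blast
    then show ?thesis unfolding complete_family_def by blast
  qed
  ultimately show ?thesis unfolding minimal_complete_family_def by blast
qed

section \<open>Decomposing a minimal Ramsey graph\<close>

text \<open>If \<open>N(u) \<subseteq> N(w)\<close>, then a free coloring of \<open>G - u\<close> extends to \<open>G\<close> by giving \<open>ux\<close> the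
  color of \<open>wx\<close>.\<close>

lemma minimal_ramsey33_neighborhood:
  assumes min: "minimal_ramsey33 G" and uw: "u \<in> verts G" "w \<in> verts G" "u \<noteq> w"
  shows "\<not> neighborhood G u \<subseteq> neighborhood G w"
proof
  assume sub: "neighborhood G u \<subseteq> neighborhood G w"
  have s: "simple_graph G" using min by (simp add: minimal_ramsey33_def)
  let ?H = "induced G (verts G - {u})"
  have sH: "simple_graph ?H" using s by (intro simple_graph_induced) auto
  have "subgraph ?H G" using sH by (auto simp: subgraph_def induced_def)
  moreover have "?H \<noteq> G" using uw by (metis DiffD2 graph.sel(1) induced_def singletonI)
  ultimately obtain c where c: "free33 ?H c"
    using min unfolding minimal_ramsey33_def ramsey33_iff by blast
  have eH: "{x, y} \<in> edges ?H \<longleftrightarrow> {x, y} \<in> edges G \<and> x \<noteq> u \<and> y \<noteq> u" for x y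
    using edge_in_simple_graph[OF s] by (auto simp: induced_def)
  have N: "{w, x} \<in> edges G" "x \<noteq> u" if "{u, x} \<in> edges G" for x
  proof -
    have "x \<in> neighborhood G u"
      using that edge_in_simple_graph(3)[OF s that] by (simp add: neighborhood_def insert_commute)
    with sub show "{w, x} \<in> edges G" by (auto simp: neighborhood_def insert_commute)
    show "x \<noteq> u" using edge_in_simple_graph(1)[OF s that] by simp
  qed
  define c' where "c' e = (if u \<in> e then c (insert w (e - {u})) else c e)" for e
  have c'u: "c' {u, x} = c {w, x}" if "x \<noteq> u" for x
    using that by (simp add: c'_def insert_Diff_if)
  have c'o: "c' {x, y} = c {x, y}" if "x \<noteq> u" "y \<noteq> u" for x y
    using that by (simp add: c'_def)
  note c = c[unfolded free33_iff[OF sH], rule_format, unfolded eH]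
  \<comment> \<open>A monochromatic triangle on \<open>u\<close>, \<open>y\<close>, \<open>z\<close>
    would give one on \<open>w\<close>, \<open>y\<close>, \<open>z\<close>, which lies in
    \<open>?H\<close>.\<close>
  have key: "\<not> (c' {u, y} = c' {y, z} \<and> c' {u, y} = c' {u, z})"
    if e: "{u, y} \<in> edges G" "{y, z} \<in> edges G" "{u, z} \<in> edges G" for y z
    using c[of w y z] N[OF e(1)] N[OF e(3)] e(2) uw c'u c'o by auto
  have "free33 G c'"
    unfolding free33_iff[OF s]
  proof (intro allI impI)
    fix x y z assume e: "{x, y} \<in> edges G \<and> {y, z} \<in> edges G \<and> {x, z} \<in> edges G"
    consider "x = u" | "y = u" | "z = u" | "x \<noteq> u" "y \<noteq> u" "z \<noteq> u" by blast
    then show "\<not> (c' {x, y} = c' {y, z} \<and> c' {x, y} = c' {x, z})"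
    proof cases
      case 1 then show ?thesis using key[of y z] e by auto
    next
      case 2 then show ?thesis using key[of x z] e by (auto simp: insert_commute)
    next
      case 3 then show ?thesis using key[of x y] e by (auto simp: insert_commute)
    next
      case 4 then show ?thesis using c[of x y z] e c'o by auto
    qed
  qed
  then show False using min unfolding minimal_ramsey33_def ramsey33_iff by blast
qed

text \<open>\<open>G\<close> is rebuilt exactly from \<open>G - I\<close> by adding \<open>I\<close>
  back, with the neighborhoods of its vertices as the family of marked sets.\<close>

lemma formed_graphs_minimal_ramsey33:
  fixes G :: "'a::infinite graph"
  assumes min: "minimal_ramsey33 G" and clique: "clique_number G < q"
    and I: "is_independent G I" "I \<noteq> {}" and A: "induced G (verts G - I) \<in> A"
  shows "G \<in> formed_graphs q A"
proof -
  have s: "simple_graph G" using min by (simp add: minimal_ramsey33_def)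
  have IV: "I \<subseteq> verts G" using I by (simp add: is_independent_def)
  let ?H = "induced G (verts G - I)" and ?S = "neighborhood G ` I"
  let ?v = "inv_into I (neighborhood G)"
  have vH: "verts ?H = verts G - I" by (simp add: induced_def)
  \<comment> \<open>Equal neighborhoods would in particular be nested, which minimality forbids.
    Hence \<open>?v\<close> sends each neighborhood back to its own vertex.\<close>
  have inj: "inj_on (neighborhood G) I"
    using minimal_ramsey33_neighborhood[OF min] IV by (intro inj_onI) blast
  have vN: "?v (neighborhood G i) = i" if "i \<in> I" for i
    using that inj by simp
  have nI: "neighborhood G i \<subseteq> verts G - I" if "i \<in> I" for i
    using that I(1) edge_in_simple_graph[OF s]
    unfolding neighborhood_def is_independent_iff by blast
  have vS: "?v ` ?S = I" using vN by force
  have va: "vertex_addition ?H ?S ?v"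
  proof
    show "simple_graph ?H" using s by (intro simple_graph_induced) auto
    show "?S \<subseteq> Pow (verts ?H)" using nI vH by blast
    show "inj_on ?v ?S" by (simp add: inj_on_inv_into)
    show "?v ` ?S \<inter> verts ?H = {}" using vS vH by auto
  qed
  interpret vertex_addition ?H ?S ?v by fact
  have "{{?v M, u} |M u. M \<in> ?S \<and> u \<in> M} = {{i, u} |i u. i \<in> I \<and> u \<in> neighborhood G i}"
  proof (intro equalityI subsetI)
    fix e assume "e \<in> {{?v M, u} |M u. M \<in> ?S \<and> u \<in> M}"
    then obtain i u where "i \<in> I" "u \<in> neighborhood G i" "e = {?v (neighborhood G i), u}" by blast
    then show "e \<in> {{i, u} |i u. i \<in> I \<and> u \<in> neighborhood G i}" using vN by auto
  next
    fix e assume "e \<in> {{i, u} |i u. i \<in> I \<and> u \<in> neighborhood G i}"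
    then obtain i u where "i \<in> I" "u \<in> neighborhood G i" "e = {i, u}" by blast
    then have "e = {?v (neighborhood G i), u}" "neighborhood G i \<in> ?S" "u \<in> neighborhood G i"
      using vN by auto
    then show "e \<in> {{?v M, u} |M u. M \<in> ?S \<and> u \<in> M}" by blast
  qed
  then have "edges (add_vertices ?H ?S ?v) =
      edges ?H \<union> {{i, u} |i u. i \<in> I \<and> u \<in> neighborhood G i}"
    unfolding add_vertices_def by simp
  also have "\<dots> = edges G"
  proof (intro equalityI subsetI)
    fix e assume "e \<in> edges ?H \<union> {{i, u} |i u. i \<in> I \<and> u \<in> neighborhood G i}"
    then show "e \<in> edges G" by (auto simp: induced_def neighborhood_def insert_commute)
  next
    fix e assume e: "e \<in> edges G"
    then obtain x y where xy: "e = {x, y}" "x \<noteq> y" "x \<in> verts G" "y \<in> verts G"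
      using simple_graph_edgeE[OF s] by blast
    show "e \<in> edges ?H \<union> {{i, u} |i u. i \<in> I \<and> u \<in> neighborhood G i}"
    proof (cases "x \<in> I \<or> y \<in> I")
      case True
      then obtain i u where "e = {i, u}" "i \<in> I" "u \<in> verts G" using xy by blast
      moreover from this have "u \<in> neighborhood G i"
        using e by (auto simp: neighborhood_def insert_commute)
      ultimately show ?thesis by blast
    next
      case False
      then show ?thesis using e xy by (auto simp: induced_def)
    qed
  qed
  finally have G: "add_vertices ?H ?S ?v = G"
    using IV vS vH by (intro graph.expand) (auto simp: verts_G)
  have mcf: "minimal_complete_family ?H ?S"
    using minimal_complete_family_if_minimal_ramsey33[OF va] min G by simp
  have "?S \<subseteq> marked_candidates q ?H"
  proof
    fix M assume "M \<in> ?S"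
    then obtain i where i: "i \<in> I" "M = neighborhood G i" by blast
    \<comment> \<open>Together with \<open>i\<close>, a complete graph on \<open>q - 1\<close>
      neighbors of \<open>i\<close> would be a clique of at least \<open>q\<close> vertices in
      \<open>G\<close>.\<close>
    have "\<not> contains_complete (induced ?H M) (q - 1)"
    proof
      assume "contains_complete (induced ?H M) (q - 1)"
      then obtain K where K: "is_clique (induced ?H M) K" "finite K" "card K = q - 1"
        unfolding contains_complete_def by blast
      have KM: "K \<subseteq> M" using K by (simp add: is_clique_def induced_def)
      have "i \<notin> K" using KM i nI by blast
      moreover have "is_clique G (insert i K)"
        unfolding is_clique_iff
      proof (intro conjI ballI impI)
        show "insert i K \<subseteq> verts G" using i IV KM nI by blast
        fix x y assume xy: "x \<in> insert i K" "y \<in> insert i K" "x \<noteq> y"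
        have "{i, u} \<in> edges G" "{u, i} \<in> edges G" if "u \<in> K" for u
          using that KM i by (auto simp: neighborhood_def insert_commute)
        moreover have "{x, y} \<in> edges G" if "x \<in> K" "y \<in> K"
          using that K(1) xy(3) by (auto simp: is_clique_iff induced_def)
        ultimately show "{x, y} \<in> edges G" using xy by blast
      qed
      then have "card (insert i K) < q"
        using clique s clique_number_less_iff unfolding simple_graph_def by blast
      ultimately show False using K by simp
    qed
    \<comment> \<open>Passing to \<open>?H\<close> only shrinks the neighborhood of
      \<open>w\<close>, so non-containment is inherited from \<open>G\<close>.\<close>
    moreover have "\<not> M \<subseteq> neighborhood ?H w" if "w \<in> verts ?H" for w
    proof -
      have "neighborhood ?H w \<subseteq> neighborhood G w"
        by (auto simp: neighborhood_def induced_def)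
      moreover have "w \<in> verts G" "i \<in> verts G" "i \<noteq> w" using that i IV vH by auto
      ultimately show ?thesis
        using minimal_ramsey33_neighborhood[OF min] i by blast
    qed
    moreover have "marked ?H M"
      using mcf \<open>M \<in> ?S\<close> unfolding minimal_complete_family_def complete_family_def by blast
    ultimately show "M \<in> marked_candidates q ?H"
      unfolding marked_candidates_def marked_def by blast
  qed
  moreover have "?S \<noteq> {}" using I by simp
  ultimately show ?thesis
    unfolding formed_graphs_def using A G mcf inj new
    by (intro CollectI exI[of _ ?H] exI[of _ ?S] exI[of _ ?v])
      (auto simp: inj_on_inv_into)
qed

text \<open>The coloring of \<open>K\<^sub>5\<close> by the edges and the diagonals of a pentagon has no monochromatic
  triangle; it is pulled back along a proper vertex coloring.\<close>

lemma not_ramsey33_if_5_colorable: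
  assumes s: "simple_graph G" and f: "proper_vertex_coloring G 5 f"
  shows "\<not> ramsey33 G"
proof -
  define pent where "pent D \<longleftrightarrow> D \<in> {{0, 1}, {1, 2}, {2, 3}, {3, 4}, {0, 4}}" for D :: "nat set"
  have pent: "\<not> (pent {a, b} = pent {b, c} \<and> pent {a, b} = pent {a, c})"
    if "a < 5" "b < 5" "c < 5" "a \<noteq> b" "b \<noteq> c" "a \<noteq> c" for a b c
  proof -
    have "a \<in> {0, 1, 2, 3, 4}" "b \<in> {0, 1, 2, 3, 4}" "c \<in> {0, 1, 2, 3, 4}" using that by auto
    then show ?thesis using that(4-6) unfolding pent_def
      by (elim insertE emptyE) (simp_all add: doubleton_eq_iff)
  qed
  have "free33 G (\<lambda>e. pent (f ` e))"
    unfolding free33_iff[OF s]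
  proof (intro allI impI)
    fix x y z assume e: "{x, y} \<in> edges G \<and> {y, z} \<in> edges G \<and> {x, z} \<in> edges G"
    then have v: "x \<in> verts G" "y \<in> verts G" "z \<in> verts G"
      using edge_in_simple_graph[OF s] by blast+
    then have "f x < 5" "f y < 5" "f z < 5" "f x \<noteq> f y" "f y \<noteq> f z" "f x \<noteq> f z"
      using f e unfolding proper_vertex_coloring_def by blast+
    from pent[OF this]
    show "\<not> (pent (f ` {x, y}) = pent (f ` {y, z}) \<and> pent (f ` {x, y}) = pent (f ` {x, z}))"
      by simp
  qed
  then show ?thesis unfolding ramsey33_iff by blast
qed

section \<open>Chromatic number after removing an independent set\<close>

text \<open>The \<open>LEAST\<close> is attained once some proper coloring exists; numbering the
  vertices injectively provides one.\<close>

lemma proper_vertex_coloring_chromatic_number: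
  assumes "simple_graph G"
  shows "\<exists>f. proper_vertex_coloring G (chromatic_number G) f"
proof -
  obtain f :: "'a \<Rightarrow> nat" where f: "bij_betw f (verts G) {0..<card (verts G)}"
    using assms ex_bij_betw_finite_nat unfolding simple_graph_def by blast
  have "f x \<noteq> f y" if "{x, y} \<in> edges G" for x y
    using edge_in_simple_graph[OF assms that] f by (auto simp: bij_betw_def dest: inj_onD)
  then have "proper_vertex_coloring G (card (verts G)) f"
    using f by (auto simp: proper_vertex_coloring_def bij_betw_def)
  then show ?thesis unfolding chromatic_number_def
    by (rule LeastI[of "\<lambda>n. \<exists>f. proper_vertex_coloring G n f", OF exI])
qed

lemma chromatic_number_remove_independent:
  assumes s: "simple_graph G" and r: "ramsey33 G" and I: "is_independent G I"
  shows "chromatic_number (induced G (verts G - I)) \<ge> 5"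
proof (rule ccontr)
  let ?H = "induced G (verts G - I)"
  assume less: "\<not> chromatic_number ?H \<ge> 5"
  have sH: "simple_graph ?H" using s by (intro simple_graph_induced) auto
  obtain f where f: "proper_vertex_coloring ?H (chromatic_number ?H) f"
    using proper_vertex_coloring_chromatic_number[OF sH] by blast
  \<comment> \<open>Color 4 is still free: with fewer than five colors on \<open>?H\<close>, all
    values of \<open>f\<close> there are below 4. The whole set \<open>I\<close> can share
    it.\<close>
  define g where "g x = (if x \<in> I then 4 else f x)" for x
  have f4: "f x < 4" if "x \<in> verts G - I" for x
  proof -
    have "f x < chromatic_number ?H"
      using that f unfolding proper_vertex_coloring_def induced_def by auto
    with less show ?thesis by simp
  qed
  have "proper_vertex_coloring G 5 g"
    unfolding proper_vertex_coloring_def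
  proof (intro conjI ballI impI)
    show "g ` verts G \<subseteq> {..<5}"
    proof
      fix n assume "n \<in> g ` verts G"
      then obtain x where "x \<in> verts G" "n = g x" by blast
      then show "n \<in> {..<5}" using f4[of x] by (auto simp: g_def)
    qed
    fix x y assume xy: "x \<in> verts G" "y \<in> verts G" "{x, y} \<in> edges G"
    then have "\<not> (x \<in> I \<and> y \<in> I)"
      using I edge_in_simple_graph(1)[OF s] unfolding is_independent_iff by blast
    moreover have "f x \<noteq> f y" if "x \<notin> I" "y \<notin> I"
      using that f xy by (auto simp: proper_vertex_coloring_def induced_def)
    ultimately show "g x \<noteq> g y" using f4[of x] f4[of y] xy by (auto simp: g_def)
  qed
  then show False using not_ramsey33_if_5_colorable[OF s] r by blast
qed

section \<open>Transport to the chosen representatives\<close>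

lemma map_graph_induced:
  assumes "simple_graph G" "inj_on f (verts G)" "W \<subseteq> verts G"
  shows "map_graph f (induced G W) = induced (map_graph f G) (f ` W)"
proof -
  have sub: "f ` e \<subseteq> f ` W \<longleftrightarrow> e \<subseteq> W" if "e \<in> edges G" for e
  proof -
    have "e \<subseteq> verts G" using simple_graph_edgeE[OF assms(1) that] by blast
    then show ?thesis using assms(2,3) by (fastforce dest: inj_onD)
  qed
  have "(`) f ` {e \<in> edges G. e \<subseteq> W} = {e \<in> (`) f ` edges G. e \<subseteq> f ` W}"
  proof (intro equalityI subsetI)
    fix e' assume "e' \<in> {e \<in> (`) f ` edges G. e \<subseteq> f ` W}"
    then obtain e where e: "e \<in> edges G" "e' = f ` e" "f ` e \<subseteq> f ` W" by blast
    with sub[OF e(1)] show "e' \<in> (`) f ` {e \<in> edges G. e \<subseteq> W}" by blast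
  qed blast
  then show ?thesis by (simp add: map_graph_def induced_def)
qed

lemma map_graph_cong:
  assumes "simple_graph H" "\<And>x. x \<in> verts H \<Longrightarrow> f x = g x"
  shows "map_graph f H = map_graph g H"
proof -
  have "f ` e = g ` e" if "e \<in> edges H" for e
  proof (rule image_cong)
    show "f x = g x" if "x \<in> e" for x
      using simple_graph_edgeE[OF assms(1) \<open>e \<in> edges H\<close>] that assms(2) by blast
  qed simp
  then show ?thesis using assms(2)
    by (intro graph.expand) (auto simp: map_graph_sel cong: image_cong)
qed

text \<open>The image of \<open>W\<close> is finite, so its complement in the infinite type has room
  for an injective copy of \<open>I\<close>.\<close>

lemma inj_on_extend_infinite:
  fixes f :: "'a \<Rightarrow> 'b::infinite"
  assumes "inj_on f W" "finite W" "finite I" "W \<inter> I = {}"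
  obtains g where "inj_on g (W \<union> I)" "\<And>x. x \<in> W \<Longrightarrow> g x = f x"
proof -
  have "infinite (- f ` W)"
    using assms(2) infinite_UNIV by (simp add: finite_compl)
  from infinite_arbitrarily_large[OF this, of "card I"]
  obtain C where C: "C \<subseteq> - f ` W" "finite C" "card C = card I" by blast
  then obtain h where h: "bij_betw h I C"
    using assms finite_same_card_bij by metis
  let ?g = "\<lambda>x. if x \<in> W then f x else h x"
  have gI: "?g x = h x" if "x \<in> I" for x
    using that assms(4) by auto
  have "inj_on ?g W" using assms(1) by (simp add: inj_on_def)
  moreover have "inj_on ?g I"
    using bij_betw_imp_inj_on[OF h] gI by (simp add: inj_on_def)
  moreover have "?g ` W = f ` W" by simp
  moreover have "?g ` I = C" using gI bij_betw_imp_surj_on[OF h] by simp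
  ultimately have "inj_on ?g (W \<union> I)"
    using C(1) unfolding inj_on_Un by blast
  then show ?thesis using that[of ?g] by simp
qed

text \<open>An isomorphism from \<open>G - I\<close> onto its representative in \<open>A\<close> is extended to \<open>I\<close>, so that the
  image of \<open>G\<close> contains the representative itself as an induced subgraph.\<close>

lemma ex_iso_formed_graph:
  fixes G :: "'a::infinite graph" and A :: "'a graph set"
  assumes min: "minimal_ramsey33 G" and clique: "clique_number G < q"
    and alpha: "int (independence_number G) \<ge> int (card (verts G)) - int k"
    and pos: "int (card (verts G)) - int k \<ge> 1"
    and A: "iso_representatives A (base_graphs q k)"
  shows "\<exists>G' \<in> formed_graphs q A. graph_iso G G' \<and> minimal_ramsey33 G'"
proof -
  have s: "simple_graph G" and r: "ramsey33 G" using min by (auto simp: minimal_ramsey33_def)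
  then have fin: "finite (verts G)" by (simp add: simple_graph_def)
  have "card (verts G) - k \<le> independence_number G" using alpha by linarith
  then obtain J where J: "is_independent G J" "card (verts G) - k \<le> card J"
    using independence_number_ge_iff[OF fin] by blast
  \<comment> \<open>\<open>J\<close> is trimmed so that exactly \<open>k\<close> vertices remain, as
    \<open>base_graphs\<close> demands; \<open>pos\<close> keeps the natural subtraction from
    truncating.\<close>
  then obtain I where IJ: "I \<subseteq> J" and cI: "card I = card (verts G) - k"
    using obtain_subset_with_card_n by metis
  have I: "is_independent G I" using J IJ unfolding is_independent_iff by blast
  then have IV: "I \<subseteq> verts G" by (simp add: is_independent_def)
  have I0: "I \<noteq> {}" using cI pos by auto
  let ?W = "verts G - I"
  let ?H = "induced G ?W"
  have sH: "simple_graph ?H" using s by (intro simple_graph_induced) auto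
  have vH: "verts ?H = ?W" by (simp add: induced_def)
  have "card ?W = k"
    using cI IV fin pos card_mono[OF fin IV] by (simp add: card_Diff_subset finite_subset)
  moreover have "clique_number ?H < q"
  proof -
    have "is_clique G K" if "is_clique ?H K" for K
      using that unfolding is_clique_iff by (auto simp: induced_def)
    then show ?thesis
      using clique clique_number_less_iff[OF fin] clique_number_less_iff[of ?H] fin vH by auto
  qed
  ultimately have "?H \<in> base_graphs q k"
    using sH vH chromatic_number_remove_independent[OF s r I] by (simp add: base_graphs_def)
  then obtain H where HA: "H \<in> A" and iso: "graph_iso ?H H"
    using A unfolding iso_representatives_def by blast
  moreover from HA have "simple_graph H"
    using A by (auto simp: iso_representatives_def base_graphs_def)
  ultimately obtain f where f: "inj_on f ?W" "H = map_graph f ?H"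
    using graph_isoE[OF iso sH] vH by metis
  have "finite ?W" "finite I" "?W \<inter> I = {}" using fin IV finite_subset by auto
  then obtain g where "inj_on g (?W \<union> I)" and gf: "\<And>x. x \<in> ?W \<Longrightarrow> g x = f x"
    using inj_on_extend_infinite[OF f(1)] by metis
  moreover have "?W \<union> I = verts G" using IV by blast
  ultimately have g: "inj_on g (verts G)" by simp
  let ?G = "map_graph g G"
  \<comment> \<open>The image is \<open>H\<close> itself and not merely a copy, as membership in
    \<open>A\<close> requires.\<close>
  have "H = map_graph g ?H" using f(2) gf vH map_graph_cong[OF sH, of f g] by simp
  also have "\<dots> = induced ?G (g ` ?W)" using map_graph_induced[OF s g] by simp
  also have "g ` ?W = verts ?G - g ` I"
    using g IV by (simp add: map_graph_sel inj_on_image_set_diff)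
  finally have HI: "induced ?G (verts ?G - g ` I) \<in> A" using HA by simp
  have indep: "is_independent ?G (g ` I)"
    unfolding is_independent_iff
  proof (intro conjI ballI impI)
    show "g ` I \<subseteq> verts ?G" using IV by (auto simp: map_graph_sel)
    fix x y assume "x \<in> g ` I" "y \<in> g ` I" "x \<noteq> y"
    then obtain a b where "x = g a" "y = g b" "a \<in> I" "b \<in> I" "a \<noteq> b" by blast
    with I IV show "{x, y} \<notin> edges ?G"
      using map_graph_edge_iff[OF s g] unfolding is_independent_iff by blast
  qed
  have min': "minimal_ramsey33 ?G" using minimal_ramsey33_map[OF min g] .
  have "?G \<in> formed_graphs q A"
    using formed_graphs_minimal_ramsey33[OF min' clique_number_map_less[OF s g clique] indep _ HI] I0
    by simp
  then show ?thesis using graph_iso_map[OF s g] min' by blast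
qed

section \<open>Formed graphs have the required parameters\<close>

text \<open>The new vertices form an independent set of size \<open>card (verts G) - k\<close>,
  nonempty because \<open>S\<close> is; condition (a) on the marked sets bounds the cliques.\<close>

lemma formed_graphsD:
  fixes G :: "'a::infinite graph"
  assumes "G \<in> formed_graphs q A" "A \<subseteq> base_graphs q k"
  shows "simple_graph G" "clique_number G < q"
    "int (independence_number G) \<ge> int (card (verts G)) - int k"
    "int (card (verts G)) - int k \<ge> 1"
proof -
  obtain H S v where G: "G = add_vertices H S v" and H: "H \<in> base_graphs q k"
    and S: "S \<subseteq> marked_candidates q H" "S \<noteq> {}" and v: "inj_on v S" "v ` S \<inter> verts H = {}"
    using assms unfolding formed_graphs_def by blast
  have sH: "simple_graph H" "card (verts H) = k" "clique_number H < q"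
    using H by (auto simp: base_graphs_def)
  interpret vertex_addition H S v
    using sH S v by unfold_locales (auto simp: marked_candidates_def)
  show "simple_graph G" using simple_G G by simp
  show "clique_number G < q"
    using clique_number_less[OF sH(3)] S G unfolding marked_candidates_def by blast
  have "card S \<le> independence_number G"
    using independence_number_ge_iff[of G] simple_G is_independent_new card_image[OF v(1)]
    unfolding G simple_graph_def by (metis order_refl)
  then show "int (independence_number G) \<ge> int (card (verts G)) - int k"
    using card_verts sH G by simp
  have "card S > 0" using finite_S S by (simp add: card_gt_0_iff)
  then show "int (card (verts G)) - int k \<ge> 1" using card_verts sH G by simp
qed

theorem theorem3p10:
  fixes q k :: nat and A B\<^sub>0 B :: "'a::infinite graph set"
  assumes "q \<ge> 1" and "k \<ge> 1"
    and "iso_representatives A (base_graphs q k)"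
    and "iso_representatives B\<^sub>0 (formed_graphs q A)"
    and "B = {G \<in> B\<^sub>0. minimal_ramsey33 G}"
  shows "iso_representatives B
    {G. minimal_ramsey33 G \<and> clique_number G < q \<and>
        int (independence_number G) \<ge> int (card (verts G)) - int k \<and>
        int (card (verts G)) - int k \<ge> 1}"
proof -
  have A: "A \<subseteq> base_graphs q k" using assms(3) by (simp add: iso_representatives_def)
  have B0: "B\<^sub>0 \<subseteq> formed_graphs q A"
    and rep: "\<And>G. G \<in> formed_graphs q A \<Longrightarrow> \<exists>!G'. G' \<in> B\<^sub>0 \<and> graph_iso G G'"
    using assms(4) by (auto simp: iso_representatives_def)
  show ?thesis
    unfolding iso_representatives_def
  proof (intro conjI subsetI ballI)
    fix G assume "G \<in> B"
    then show "G \<in> {G. minimal_ramsey33 G \<and> clique_number G < q \<and>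
        int (independence_number G) \<ge> int (card (verts G)) - int k \<and>
        int (card (verts G)) - int k \<ge> 1}"
      using assms(5) B0 formed_graphsD[OF _ A] by blast
  next
    fix G :: "'a graph"
    assume "G \<in> {G. minimal_ramsey33 G \<and> clique_number G < q \<and>
        int (independence_number G) \<ge> int (card (verts G)) - int k \<and>
        int (card (verts G)) - int k \<ge> 1}"
    then obtain G' where G': "G' \<in> formed_graphs q A" "graph_iso G G'" "minimal_ramsey33 G'"
      using ex_iso_formed_graph[OF _ _ _ _ assms(3), of G] by blast
    \<comment> \<open>The formed graph \<open>G'\<close> need not be the copy kept in
      \<open>B\<^sub>0\<close>; minimality is carried over to the kept copy, so that it survives the
      final filter.\<close>
    obtain G'' where G'': "G'' \<in> B\<^sub>0" "graph_iso G' G''" using rep[OF G'(1)] by blast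
    have "simple_graph G'" "simple_graph G''"
      using G' G'' B0 formed_graphsD(1)[OF _ A] by blast+
    then have "minimal_ramsey33 G''"
      using graph_isoE[OF G''(2)] minimal_ramsey33_map[OF G'(3)] by metis
    then have "G'' \<in> B \<and> graph_iso G G''"
      using G'' G' assms(5) graph_iso_trans by blast
    \<comment> \<open>A competitor \<open>X\<close> is isomorphic to the formed graph
      \<open>G'\<close> through \<open>G\<close>, so uniqueness in \<open>B\<^sub>0\<close>
      applies.\<close>
    moreover have "X = G''" if "X \<in> B \<and> graph_iso G X" for X
    proof -
      have "X \<in> B\<^sub>0 \<and> graph_iso G' X"
        using that assms(5) G'(2) graph_iso_sym graph_iso_trans by blast
      then show ?thesis using rep[OF G'(1)] G'' by blast
    qed
    ultimately show "\<exists>!X. X \<in> B \<and> graph_iso G X" by blast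
  qed
qed

end
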